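(* Let $\mathcal{I}\subseteq\mathcal{P}(\mathbb{N})$ be a translation invariant ideal that contains all finite subsets of $\mathbb{N}$, and assume that there exists an infinite $\mathcal{I}$-TAD family. Then there exists an abstract upper density $\delta$ that is translation invariant and rich, and such that $\mathcal{Z}_\delta=\mathcal{I}$.
   Context: $\mathbb{N}$ is the set of positive integers. For $A\subseteq\mathbb{N}$ and $k\in\mathbb{Z}$, $A+k:=\{a+k\mid a\in A,\ a+k\in\mathbb{N}\}$. An ideal is a nonempty family $\mathcal{I}\subseteq\mathcal{P}(\mathbb{N})$ with $\mathbb{N}\notin\mathcal{I}$, closed under subsets and finite unions; it is translation invariant if $A\in\mathcal{I}\Leftrightarrow A+k\in\mathcal{I}$ for every $k\in\mathbb{Z}$. Two sets $A,B\subseteq\mathbb{N}$ are $\mathcal{I}$-translation almost disjoint ($\mathcal{I}$-TAD) if $(A+s)\cap(B+t)\in\mathcal{I}$ for all $s,t\in\mathbb{Z}$. A family $\mathcal{A}\subseteq\mathcal{P}(\mathbb{N})$ is $\mathcal{I}$-TAD if $\mathcal{A}\cap\mathcal{I}=\emptyset$, all members are infinite, and any two distinct members are $\mathcal{I}$-TAD. An abstract upper density is a function $\delta:\mathcal{P}(\mathbb{N})\to[0,1]$ with $\delta(\mathbb{N})=1$, $\delta(F)=0$ for all finite $F$, $\delta(A)\le\delta(B)$ whenever $A\subseteq B$, and $\delta(A\cup B)\le\delta(A)+\delta(B)$. It is translation invariant if $\delta(A+m)=\delta(A-m)=\delta(A)$ for all $A\subseteq\mathbb{N}$, $m\in\mathbb{N}$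 (where $A-m=\{k\in\mathbb{N}\mid k+m\in A\}$), and rich if for every $r\in[0,1]$ there is $A\subseteq\mathbb{N}$ with $\delta(A)=r$. $\mathcal{Z}_\delta:=\{A\subseteq\mathbb{N}\mid\delta(A)=0\}$. *)

theory Defs
  imports Complex_Main "HOL-Library.FuncSet"
begin

text \<open>Here \<open>\<nat>\<close> is the set of positive integers, represented as the subset
  \<open>posnat\<close> of type \<^typ>\<open>nat\<close>; all conditions are relativised to it.\<close>

definition posnat :: "nat set" where
  "posnat = {n. 0 < n}"

definition translate :: "nat set \<Rightarrow> int \<Rightarrow> nat set" where
  "translate A k = {n \<in> posnat. \<exists>a\<in>A. int n = int a + k}"

definition shift_down :: "nat set \<Rightarrow> nat \<Rightarrow> nat set" where
  "shift_down A m = {k \<in> posnat. k + m \<in> A}"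

definition is_ideal :: "nat set set \<Rightarrow> bool" where
  "is_ideal I \<longleftrightarrow>
     I \<subseteq> Pow posnat \<and> I \<noteq> {} \<and> posnat \<notin> I \<and>
     (\<forall>A B. A \<in> I \<and> B \<subseteq> A \<longrightarrow> B \<in> I) \<and>
     (\<forall>A B. A \<in> I \<and> B \<in> I \<longrightarrow> A \<union> B \<in> I)"

definition translation_invariant_ideal :: "nat set set \<Rightarrow> bool" where
  "translation_invariant_ideal I \<longleftrightarrow>
     is_ideal I \<and> (\<forall>A k. A \<subseteq> posnat \<longrightarrow> (A \<in> I \<longleftrightarrow> translate A k \<in> I))"

definition TAD :: "nat set set \<Rightarrow> nat set \<Rightarrow> nat set \<Rightarrow> bool" where
  "TAD I A B \<longleftrightarrow> (\<forall>s t. translate A s \<inter> translate B t \<in> I)"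

definition TAD_family :: "nat set set \<Rightarrow> nat set set \<Rightarrow> bool" where
  "TAD_family I F \<longleftrightarrow>
     F \<subseteq> Pow posnat \<and> F \<inter> I = {} \<and> (\<forall>A\<in>F. infinite A) \<and>
     (\<forall>A\<in>F. \<forall>B\<in>F. A \<noteq> B \<longrightarrow> TAD I A B)"

text \<open>Values of \<open>\<delta>\<close> on sets containing \<open>0\<close> are irrelevant.\<close>

definition abstract_upper_density :: "(nat set \<Rightarrow> real) \<Rightarrow> bool" where
  "abstract_upper_density \<delta> \<longleftrightarrow>
     \<delta> \<in> Pow posnat \<rightarrow> {0..1} \<and>
     \<delta> posnat = 1 \<and>
     (\<forall>F. F \<subseteq> posnat \<and> finite F \<longrightarrow> \<delta> F = 0) \<and>
     (\<forall>A B. A \<subseteq> B \<and> B \<subseteq> posnat \<longrightarrow> \<delta> A \<le> \<delta> B) \<and>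
     (\<forall>A B. A \<subseteq> posnat \<and> B \<subseteq> posnat \<longrightarrow> \<delta> (A \<union> B) \<le> \<delta> A + \<delta> B)"

definition translation_invariant_density :: "(nat set \<Rightarrow> real) \<Rightarrow> bool" where
  "translation_invariant_density \<delta> \<longleftrightarrow>
     (\<forall>A m. A \<subseteq> posnat \<and> m \<in> posnat \<longrightarrow>
        \<delta> (translate A (int m)) = \<delta> A \<and> \<delta> (shift_down A m) = \<delta> A)"

definition rich :: "(nat set \<Rightarrow> real) \<Rightarrow> bool" where
  "rich \<delta> \<longleftrightarrow> (\<forall>r\<in>{0..1}. \<exists>A. A \<subseteq> posnat \<and> \<delta> A = r)"

definition zero_ideal :: "(nat set \<Rightarrow> real) \<Rightarrow> nat set set" where
  "zero_ideal \<delta> = {A. A \<subseteq> posnat \<and> \<delta> A = 0}"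

end

theory Submission
  imports Defs "HOL-Library.Infinite_Set" "HOL-Library.Countable_Set" "HOL-Library.Nat_Bijection"
begin

text \<open>Suppose that sets \<open>X i\<close> are indexed by reals \<open>i \<in> K \<subseteq> (0,1]\<close>. Say that \<open>A\<close> hits \<open>i\<close> if \<open>A\<close> meets
  some translate of \<open>X i\<close> in a set outside \<open>\<I>\<close>, and that \<open>A\<close> is detected if every subset of \<open>A\<close>
  outside \<open>\<I>\<close> hits some index. Put \<open>\<delta> A = sup {i. A hits i}\<close> if \<open>A\<close> is detected, and \<open>\<delta> A = 1\<close>
  otherwise. This is a translation invariant upper density with zero ideal \<open>\<I>\<close>; only
  richness depends on the choice of the \<open>X i\<close>.

  Refine a sequence from the given TAD family to sets \<open>D n\<close> such that unions over disjoint index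
  sets are still \<open>\<I>\<close>-TAD. If for some infinite \<open>T\<close> the union of \<open>D n\<close>, \<open>n \<in> T\<close>, is detected by the
  \<open>D n\<close>, index countably many of these by the rationals of \<open>(0,1]\<close>: the value \<open>r\<close> is attained at the
  union of those with index at most \<open>r\<close>. Otherwise every such union has a subset outside
  \<open>\<I>\<close> that hits no \<open>D n\<close>; choosing one for continuum many almost disjoint \<open>T\<close> gives an
  \<open>\<I>\<close>-TAD family indexed by all of \<open>(0,1]\<close>, whose member with index \<open>r\<close> has density \<open>r\<close>.\<close>

section \<open>Translations\<close>

lemma mem_translate: "n \<in> translate A k \<longleftrightarrow> 0 < n \<and> (\<exists>a\<in>A. int n = int a + k)"
  by (auto simp: translate_def posnat_def)

lemma translate_subset_posnat: "translate A k \<subseteq> posnat"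
  by (auto simp: translate_def)

lemma translate_0: "A \<subseteq> posnat \<Longrightarrow> translate A 0 = A"
  by (auto simp: translate_def)

lemma translate_mono: "A \<subseteq> B \<Longrightarrow> translate A k \<subseteq> translate B k"
  by (auto simp: translate_def)

lemma translate_Un: "translate (A \<union> B) k = translate A k \<union> translate B k"
  by (auto simp: translate_def)

text \<open>Equality can fail: a negative shift \<open>k\<close> discards elements that a later
  positive \<open>l\<close> cannot restore.\<close>

lemma translate_translate_subset: "translate (translate A k) l \<subseteq> translate A (k + l)"
  by (auto simp: mem_translate)

lemma translate_Int_subset: "translate (A \<inter> B) k \<subseteq> translate A k \<inter> translate B k"
  by (auto simp: translate_def)

lemma translate_translate_uminus_subset: "A \<subseteq> posnat \<Longrightarrow> translate (translate A k) (- k) \<subseteq> A"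
  using translate_translate_subset[of A k "- k"] by (simp add: translate_0)

lemma shift_down_eq_translate: "A \<subseteq> posnat \<Longrightarrow> shift_down A m = translate A (- int m)"
proof -
  have "x + m \<in> A \<longleftrightarrow> (\<exists>a\<in>A. int x = int a + - int m)" for x
  proof
    assume "x + m \<in> A"
    then show "\<exists>a\<in>A. int x = int a + - int m"
      by (intro bexI[of _ "x + m"]) auto
  next
    assume "\<exists>a\<in>A. int x = int a + - int m"
    then obtain a where "a \<in> A" "a = x + m" by fastforce
    then show "x + m \<in> A" by simp
  qed
  then show ?thesis
    by (auto simp: shift_down_def translate_def)
qed

section \<open>The density of an indexed family\<close>

text \<open>The index type is left open: indices are naturals for \<open>refined A\<close> and reals
  for the final family.\<close>

definition hits :: "nat set set \<Rightarrow> ('i \<Rightarrow> nat set) \<Rightarrow> 'i set \<Rightarrow> nat set \<Rightarrow> 'i set" where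
  "hits I X K A = {i \<in> K. \<exists>k. A \<inter> translate (X i) k \<notin> I}"

definition detected :: "nat set set \<Rightarrow> ('i \<Rightarrow> nat set) \<Rightarrow> 'i set \<Rightarrow> nat set \<Rightarrow> bool" where
  "detected I X K A \<longleftrightarrow> (\<forall>B\<subseteq>A. B \<notin> I \<longrightarrow> hits I X K B \<noteq> {})"

text \<open>Inserting 0 gives the supremum a value when nothing is hit. The value 1 for undetected
  sets keeps sets outside \<open>I\<close> that hit nothing from getting density 0.\<close>

definition hit_density :: "nat set set \<Rightarrow> (real \<Rightarrow> nat set) \<Rightarrow> real set \<Rightarrow> nat set \<Rightarrow> real" where
  "hit_density I X K A = (if detected I X K A then Sup (insert 0 (hits I X K A)) else 1)"

lemma detected_subset: "detected I X K A \<Longrightarrow> B \<subseteq> A \<Longrightarrow> detected I X K B"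
  by (auto simp: detected_def)

locale translation_ideal =
  fixes I :: "nat set set"
  assumes translation_invariant: "translation_invariant_ideal I"
begin

lemma subset_posnat: "A \<in> I \<Longrightarrow> A \<subseteq> posnat"
  and subset_in: "A \<in> I \<Longrightarrow> B \<subseteq> A \<Longrightarrow> B \<in> I"
  and Un_in: "A \<in> I \<Longrightarrow> B \<in> I \<Longrightarrow> A \<union> B \<in> I"
  and empty_in: "{} \<in> I"
  and translate_in_iff: "A \<subseteq> posnat \<Longrightarrow> translate A k \<in> I \<longleftrightarrow> A \<in> I"
proof -
  have ideal: "is_ideal I" and "\<forall>A k. A \<subseteq> posnat \<longrightarrow> (A \<in> I \<longleftrightarrow> translate A k \<in> I)"
    using translation_invariant by (auto simp: translation_invariant_ideal_def)
  then show "A \<subseteq> posnat \<Longrightarrow> translate A k \<in> I \<longleftrightarrow> A \<in> I" by blast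
  note ideal = ideal[unfolded is_ideal_def]
  show "A \<in> I \<Longrightarrow> A \<subseteq> posnat" using ideal by auto
  show sub: "A \<in> I \<Longrightarrow> B \<subseteq> A \<Longrightarrow> B \<in> I" for A B using ideal by simp
  show "A \<in> I \<Longrightarrow> B \<in> I \<Longrightarrow> A \<union> B \<in> I" using ideal by simp
  show "{} \<in> I" using ideal sub by blast
qed

lemma UN_in: "finite N \<Longrightarrow> (\<And>n. n \<in> N \<Longrightarrow> A n \<in> I) \<Longrightarrow> (\<Union>n\<in>N. A n) \<in> I"
  by (induction N rule: finite_induct) (auto intro: empty_in Un_in)

section \<open>Hits and detection under unions and translations\<close>

lemma hits_mono: "A \<subseteq> B \<Longrightarrow> hits I X K A \<subseteq> hits I X K B"
  by (auto simp: hits_def dest: subset_in[OF _ Int_mono[OF _ order_refl]])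

lemma hits_Un: "hits I X K (A \<union> B) = hits I X K A \<union> hits I X K B"
proof
  show "hits I X K (A \<union> B) \<subseteq> hits I X K A \<union> hits I X K B"
    unfolding hits_def by (auto simp: Int_Un_distrib2 dest: Un_in)
  show "hits I X K A \<union> hits I X K B \<subseteq> hits I X K (A \<union> B)"
    by (simp add: hits_mono)
qed

lemma hits_eq_empty: "A \<in> I \<Longrightarrow> hits I X K A = {}"
  unfolding hits_def using subset_in by blast

text \<open>Shifting the part of \<open>A\<close> that witnesses a hit by \<open>m\<close> keeps it
  outside \<open>I\<close>, even if finitely many elements fall off, and places it in the translate
  of \<open>X i\<close> by \<open>k + m\<close>.\<close>

lemma hits_subset_translate:
  assumes "A \<subseteq> posnat" shows "hits I X K A \<subseteq> hits I X K (translate A m)"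
proof
  fix i assume "i \<in> hits I X K A"
  then obtain k where i: "i \<in> K" and k: "A \<inter> translate (X i) k \<notin> I"
    by (auto simp: hits_def)
  have "translate (A \<inter> translate (X i) k) m \<notin> I"
    using k assms by (subst translate_in_iff) auto
  moreover have "translate (A \<inter> translate (X i) k) m \<subseteq> translate A m \<inter> translate (X i) (k + m)"
    using translate_Int_subset translate_translate_subset by fast
  ultimately have "translate A m \<inter> translate (X i) (k + m) \<notin> I"
    using subset_in by blast
  with i show "i \<in> hits I X K (translate A m)"
    by (auto simp: hits_def)
qed

lemma hits_translate:
  assumes "A \<subseteq> posnat" shows "hits I X K (translate A m) = hits I X K A"
proof
  have "hits I X K (translate A m) \<subseteq> hits I X K (translate (translate A m) (- m))"
    by (rule hits_subset_translate) (rule translate_subset_posnat)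
  also have "\<dots> \<subseteq> hits I X K A"
    by (intro hits_mono translate_translate_uminus_subset assms)
  finally show "hits I X K (translate A m) \<subseteq> hits I X K A" .
qed (rule hits_subset_translate[OF assms])

text \<open>A set outside \<open>I\<close> covered by \<open>A\<close> and \<open>B\<close> has a
  trace outside \<open>I\<close> on one of them, and that trace already hits an index.\<close>

lemma detected_Un:
  assumes "detected I X K A" "detected I X K B" shows "detected I X K (A \<union> B)"
  unfolding detected_def
proof (intro allI impI)
  fix C assume C: "C \<subseteq> A \<union> B" "C \<notin> I"
  have "C = (C \<inter> A) \<union> (C \<inter> B)" using C by blast
  then have "C \<inter> A \<notin> I \<or> C \<inter> B \<notin> I" using C Un_in by metis
  then have "hits I X K (C \<inter> A) \<noteq> {} \<or> hits I X K (C \<inter> B) \<noteq> {}"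
    using assms by (auto simp: detected_def)
  then show "hits I X K C \<noteq> {}"
    using hits_mono[of "C \<inter> A" C X K] hits_mono[of "C \<inter> B" C X K] by blast
qed

lemma detected_in: "A \<in> I \<Longrightarrow> detected I X K A"
  using subset_in by (auto simp: detected_def)

lemma detected_translate:
  assumes "A \<subseteq> posnat" shows "detected I X K (translate A m) \<longleftrightarrow> detected I X K A"
proof
  assume det: "detected I X K (translate A m)"
  show "detected I X K A"
    unfolding detected_def
  proof (intro allI impI)
    fix B assume B: "B \<subseteq> A" "B \<notin> I"
    then have pos: "B \<subseteq> posnat" using assms by blast
    then have "translate B m \<notin> I" using B by (simp add: translate_in_iff)
    then have "hits I X K (translate B m) \<noteq> {}"
      using det translate_mono[OF B(1)] by (auto simp: detected_def)
    then show "hits I X K B \<noteq> {}" using pos by (simp add: hits_translate)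
  qed
next
  assume det: "detected I X K A"
  show "detected I X K (translate A m)"
    unfolding detected_def
  proof (intro allI impI)
    fix B assume B: "B \<subseteq> translate A m" "B \<notin> I"
    then have pos: "B \<subseteq> posnat" using translate_subset_posnat by blast
    then have "translate B (- m) \<notin> I" using B by (simp add: translate_in_iff)
    moreover have "translate B (- m) \<subseteq> A"
      using translate_mono[OF B(1)] translate_translate_uminus_subset[OF assms] by blast
    ultimately have "hits I X K (translate B (- m)) \<noteq> {}"
      using det by (auto simp: detected_def)
    then show "hits I X K B \<noteq> {}" using pos by (simp add: hits_translate)
  qed
qed

lemma hit_density_translate:
  "A \<subseteq> posnat \<Longrightarrow> hit_density I X K (translate A m) = hit_density I X K A"
  by (simp add: hit_density_def hits_translate detected_translate)

section \<open>The density axioms for indices in the half-open unit interval\<close>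

context
  fixes X :: "real \<Rightarrow> nat set" and K :: "real set"
  assumes K: "K \<subseteq> {0<..1}"
begin

lemma bdd_above_hits: "bdd_above (insert 0 (hits I X K A))"
proof (rule bdd_aboveI)
  fix x assume "x \<in> insert 0 (hits I X K A)"
  then show "x \<le> 1" using K by (auto simp: hits_def)
qed

lemma Sup_hits_nonneg: "0 \<le> Sup (insert 0 (hits I X K A))"
  by (rule cSup_upper) (simp, rule bdd_above_hits)

lemma Sup_hits_le_1: "Sup (insert 0 (hits I X K A)) \<le> 1"
  using K by (intro cSup_least) (auto simp: hits_def)

lemma hit_density_nonneg: "0 \<le> hit_density I X K A"
  and hit_density_le_1: "hit_density I X K A \<le> 1"
  using Sup_hits_nonneg Sup_hits_le_1 by (auto simp: hit_density_def)

lemma hit_density_mono: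
  assumes "A \<subseteq> B" shows "hit_density I X K A \<le> hit_density I X K B"
proof (cases "detected I X K B")
  case True
  then have "detected I X K A" using assms by (rule detected_subset)
  moreover have "Sup (insert 0 (hits I X K A)) \<le> Sup (insert 0 (hits I X K B))"
    by (intro cSup_subset_mono insert_mono hits_mono assms bdd_above_hits) simp
  ultimately show ?thesis using True by (simp add: hit_density_def)
next
  case False
  then show ?thesis using hit_density_le_1 by (simp add: hit_density_def)
qed

text \<open>If both sets are detected, every hit of the union is a hit of one of them. Otherwise one
  summand is already 1.\<close>

lemma hit_density_Un: "hit_density I X K (A \<union> B) \<le> hit_density I X K A + hit_density I X K B"
proof (cases "detected I X K A \<and> detected I X K B")
  case True
  have "Sup (insert 0 (hits I X K (A \<union> B)))
    \<le> Sup (insert 0 (hits I X K A)) + Sup (insert 0 (hits I X K B))"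
  proof (rule cSup_least)
    fix x assume "x \<in> insert 0 (hits I X K (A \<union> B))"
    then have "x \<in> insert 0 (hits I X K A) \<or> x \<in> insert 0 (hits I X K B)"
      by (auto simp: hits_Un)
    then have "x \<le> Sup (insert 0 (hits I X K A)) \<or> x \<le> Sup (insert 0 (hits I X K B))"
      by (auto simp only: intro: cSup_upper[OF _ bdd_above_hits])
    then show "x \<le> Sup (insert 0 (hits I X K A)) + Sup (insert 0 (hits I X K B))"
      using Sup_hits_nonneg[of A] Sup_hits_nonneg[of B] by linarith
  qed simp
  then show ?thesis using True by (simp add: hit_density_def detected_Un)
next
  case False
  then have "1 \<le> hit_density I X K A + hit_density I X K B"
    using hit_density_nonneg[of A] hit_density_nonneg[of B] by (auto simp: hit_density_def)
  then show ?thesis using hit_density_le_1[of "A \<union> B"] by linarith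
qed

lemma hit_density_eq_0_iff: "hit_density I X K A = 0 \<longleftrightarrow> A \<in> I"
proof
  assume "A \<in> I"
  then show "hit_density I X K A = 0"
    by (simp add: hit_density_def detected_in hits_eq_empty)
next
  assume 0: "hit_density I X K A = 0"
  then have det: "detected I X K A" by (auto simp: hit_density_def split: if_splits)
  show "A \<in> I"
  proof (rule ccontr)
    assume "A \<notin> I"
    then obtain i where i: "i \<in> hits I X K A" using det by (auto simp: detected_def)
    then have "i \<le> Sup (insert 0 (hits I X K A))"
      by (intro cSup_upper bdd_above_hits) auto
    \<comment> \<open>Indices exclude 0, so a single hit forces positive density.\<close>
    moreover have "0 < i" using i K by (auto simp: hits_def)
    ultimately show False using 0 det by (simp add: hit_density_def)
  qed
qed

text \<open>The index 1 secures the value 1 in case \<open>posnat\<close> is detected.\<close>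

lemma hit_density_posnat:
  assumes "1 \<in> K" "X 1 \<subseteq> posnat" "X 1 \<notin> I"
  shows "hit_density I X K posnat = 1"
proof -
  have "posnat \<inter> translate (X 1) 0 \<notin> I"
    using assms by (simp add: translate_0 Int_absorb1)
  then have "1 \<in> hits I X K posnat" using assms by (auto simp: hits_def)
  then have "1 \<le> Sup (insert 0 (hits I X K posnat))"
    by (intro cSup_upper bdd_above_hits) auto
  then show ?thesis using Sup_hits_le_1[of posnat] by (simp add: hit_density_def)
qed

lemma hit_density_properties:
  assumes "1 \<in> K" "X 1 \<subseteq> posnat" "X 1 \<notin> I" and fin: "\<forall>F. F \<subseteq> posnat \<and> finite F \<longrightarrow> F \<in> I"
  shows "abstract_upper_density (hit_density I X K)"
    and "translation_invariant_density (hit_density I X K)"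
    and "zero_ideal (hit_density I X K) = I"
proof -
  show "abstract_upper_density (hit_density I X K)"
    unfolding abstract_upper_density_def
    using hit_density_nonneg hit_density_le_1 hit_density_mono hit_density_Un
      hit_density_eq_0_iff hit_density_posnat[OF assms(1-3)] fin by auto
  show "translation_invariant_density (hit_density I X K)"
    unfolding translation_invariant_density_def
    by (auto simp: shift_down_eq_translate hit_density_translate)
  show "zero_ideal (hit_density I X K) = I"
    unfolding zero_ideal_def using hit_density_eq_0_iff subset_posnat by blast
qed

end

end

section \<open>Refining a sequence of translation almost disjoint sets\<close>

text \<open>The window of removed shifts grows with \<open>n\<close>: each stage removes finitely
  many translates, while any fixed shift is covered at all but finitely many stages.\<close>

definition refined :: "(nat \<Rightarrow> nat set) \<Rightarrow> nat \<Rightarrow> nat set" where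
  "refined A n = A n - (\<Union>m<n. \<Union>k\<in>{- int n..int n}. translate (A m) k)"

definition union_over :: "(nat \<Rightarrow> nat set) \<Rightarrow> nat set \<Rightarrow> nat set" where
  "union_over A T = (\<Union>n\<in>T. refined A n)"

lemma refined_subset: "refined A n \<subseteq> A n"
  by (auto simp: refined_def)

lemma union_over_singleton: "union_over A {n} = refined A n"
  by (simp add: union_over_def)

locale TAD_sequence = translation_ideal I for I +
  fixes A :: "nat \<Rightarrow> nat set"
  assumes A_pos: "A n \<subseteq> posnat"
    and A_notin: "A n \<notin> I"
    and A_TAD: "n \<noteq> m \<Longrightarrow> TAD I (A n) (A m)"
begin

lemma refined_pos: "refined A n \<subseteq> posnat"
  using refined_subset A_pos by blast

lemma union_over_pos: "union_over A T \<subseteq> posnat"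
  using refined_pos by (auto simp: union_over_def)

lemma A_Int_translate_in: "n \<noteq> m \<Longrightarrow> A n \<inter> translate (A m) k \<in> I"
  using A_TAD[of n m] A_pos[of n] unfolding TAD_def by (metis translate_0)

text \<open>What is removed from \<open>A n\<close> is a finite union of sets in
  \<open>I\<close>.\<close>

lemma refined_notin: "refined A n \<notin> I"
proof
  assume "refined A n \<in> I"
  moreover have "(\<Union>m<n. \<Union>k\<in>{- int n..int n}. A n \<inter> translate (A m) k) \<in> I"
    by (intro UN_in A_Int_translate_in) auto
  ultimately have "refined A n \<union> (\<Union>m<n. \<Union>k\<in>{- int n..int n}. A n \<inter> translate (A m) k) \<in> I"
    by (rule Un_in)
  moreover have "A n \<subseteq> refined A n \<union> (\<Union>m<n. \<Union>k\<in>{- int n..int n}. A n \<inter> translate (A m) k)"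
    by (auto simp: refined_def)
  ultimately show False using A_notin subset_in by blast
qed

lemma refined_Int_translate_empty:
  assumes "n \<noteq> m" "\<bar>k\<bar> \<le> int (max n m)"
  shows "refined A n \<inter> translate (refined A m) k = {}"
proof (cases "m < n")
  case True
  then have "k \<in> {- int n..int n}" using assms by auto
  moreover have "translate (refined A m) k \<subseteq> translate (A m) k"
    by (rule translate_mono[OF refined_subset])
  ultimately show ?thesis using True unfolding refined_def by blast
next
  case False
  then have less: "n < m" using assms by simp
  then have k: "- k \<in> {- int m..int m}" using assms by auto
  show ?thesis
  proof (rule ccontr)
    assume "refined A n \<inter> translate (refined A m) k \<noteq> {}"
    then obtain x y where x: "x \<in> refined A n" and y: "y \<in> refined A m" and eq: "int x = int y + k"
      by (auto simp: mem_translate)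
    \<comment> \<open>Translates contain only positive numbers, so \<open>y\<close>, which is
      \<open>x\<close> shifted by \<open>- k\<close>, must be known to be positive.\<close>
    have "0 < y" using y refined_pos by (auto simp: posnat_def)
    then have "y \<in> translate (A n) (- k)"
      using x eq refined_subset by (auto simp: mem_translate intro!: bexI[of _ x])
    then have "y \<notin> refined A m" using less k unfolding refined_def by blast
    then show False using y by simp
  qed
qed

text \<open>For a fixed shift only pairs of indices both below its absolute value can contribute,
  which leaves a finite union of sets in \<open>I\<close>.\<close>

lemma union_over_Int_translate_in:
  assumes "T \<inter> T' = {}"
  shows "union_over A T \<inter> translate (union_over A T') k \<in> I"
proof -
  define N where "N = {(n, m). n \<noteq> m \<and> n < nat \<bar>k\<bar> \<and> m < nat \<bar>k\<bar>}"
  have "N \<subseteq> {..<nat \<bar>k\<bar>} \<times> {..<nat \<bar>k\<bar>}" by (auto simp: N_def)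
  then have "finite N" by (rule finite_subset) simp
  then have "(\<Union>p\<in>N. A (fst p) \<inter> translate (A (snd p)) k) \<in> I"
    by (rule UN_in) (auto simp: N_def intro!: A_Int_translate_in)
  moreover have "union_over A T \<inter> translate (union_over A T') k
    \<subseteq> (\<Union>p\<in>N. A (fst p) \<inter> translate (A (snd p)) k)"
  proof
    fix x assume "x \<in> union_over A T \<inter> translate (union_over A T') k"
    then obtain n m where nm: "n \<in> T" "m \<in> T'"
      and x: "x \<in> refined A n" "x \<in> translate (refined A m) k"
      by (auto simp: union_over_def mem_translate)
    have "n \<noteq> m" using nm assms by blast
    then have "\<not> \<bar>k\<bar> \<le> int (max n m)"
      using refined_Int_translate_empty[of n m k] x by blast
    with \<open>n \<noteq> m\<close> have "(n, m) \<in> N" by (auto simp: N_def)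
    moreover have "x \<in> A n \<inter> translate (A m) k"
      using x refined_subset translate_mono[OF refined_subset] by blast
    ultimately show "x \<in> (\<Union>p\<in>N. A (fst p) \<inter> translate (A (snd p)) k)" by force
  qed
  ultimately show ?thesis using subset_in by blast
qed

text \<open>On the finitely many common indices each of \<open>B\<close>, \<open>B'\<close> leaves
  only a set in \<open>I\<close>, since it hits none of them. The remaining indices form disjoint
  sets, where the previous lemma applies.\<close>

lemma undetected_Int_translate_in:
  assumes fin: "finite (T \<inter> T')"
    and sub: "B \<subseteq> union_over A T" "B' \<subseteq> union_over A T'"
    and hits: "hits I (refined A) UNIV B = {}" "hits I (refined A) UNIV B' = {}"
  shows "B \<inter> translate B' k \<in> I"
proof -
  have meet: "C \<inter> union_over A (T \<inter> T') \<in> I" if "hits I (refined A) UNIV C = {}" for C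
  proof -
    \<comment> \<open>Missing the index \<open>n\<close> is used for the shift 0 only.\<close>
    have "C \<inter> refined A n \<in> I" for n
      using that translate_0[OF refined_pos[of n]] unfolding hits_def
      by (metis (mono_tags, lifting) UNIV_I empty_Collect_eq)
    then have "(\<Union>n\<in>T \<inter> T'. C \<inter> refined A n) \<in> I" using fin by (intro UN_in)
    then show ?thesis by (simp add: union_over_def)
  qed
  have "translate (B' \<inter> union_over A (T \<inter> T')) k \<in> I"
    using meet[OF hits(2)] union_over_pos by (subst translate_in_iff) auto
  then have "B \<inter> union_over A (T \<inter> T') \<union> translate (B' \<inter> union_over A (T \<inter> T')) k
      \<union> (union_over A (T - T') \<inter> translate (union_over A (T' - T)) k) \<in> I"
    by (intro Un_in meet hits union_over_Int_translate_in) auto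
  moreover have "B \<inter> translate B' k \<subseteq> B \<inter> union_over A (T \<inter> T')
      \<union> translate (B' \<inter> union_over A (T \<inter> T')) k
      \<union> (union_over A (T - T') \<inter> translate (union_over A (T' - T)) k)"
  proof
    fix x assume "x \<in> B \<inter> translate B' k"
    moreover have "B \<subseteq> (B \<inter> union_over A (T \<inter> T')) \<union> union_over A (T - T')"
      using sub(1) by (auto simp: union_over_def)
    moreover have "B' \<subseteq> (B' \<inter> union_over A (T \<inter> T')) \<union> union_over A (T' - T)"
      using sub(2) by (auto simp: union_over_def)
    then have "translate B' k
        \<subseteq> translate (B' \<inter> union_over A (T \<inter> T')) k \<union> translate (union_over A (T' - T)) k"
      by (metis translate_mono translate_Un)
    ultimately show "x \<in> B \<inter> union_over A (T \<inter> T') \<union> translate (B' \<inter> union_over A (T \<inter> T')) k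
        \<union> (union_over A (T - T') \<inter> translate (union_over A (T' - T)) k)"
      by blast
  qed
  ultimately show ?thesis using subset_in by blast
qed

end

section \<open>Richness\<close>

text \<open>Distinct slopes give almost disjoint sets: \<open>\<lfloor>r n\<rfloor> \<noteq> \<lfloor>s n\<rfloor>\<close> as soon as \<open>\<bar>r - s\<bar> n \<ge> 1\<close>.\<close>

definition slope_set :: "real \<Rightarrow> nat set" where
  "slope_set r = range (\<lambda>n. prod_encode (n, nat \<lfloor>r * real n\<rfloor>))"

lemma infinite_slope_set: "infinite (slope_set r)"
proof -
  have "inj (\<lambda>n. prod_encode (n, nat \<lfloor>r * real n\<rfloor>))"
    by (rule injI) (simp add: prod_encode_eq)
  then show ?thesis unfolding slope_set_def by (simp add: finite_image_iff)
qed

lemma finite_slope_set_Int_less: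
  assumes "0 \<le> r" "r < s" shows "finite (slope_set r \<inter> slope_set s)"
proof -
  obtain N :: nat where N: "1 / (s - r) < real N"
    using reals_Archimedean2 by blast
  have "slope_set r \<inter> slope_set s \<subseteq> (\<lambda>n. prod_encode (n, nat \<lfloor>r * real n\<rfloor>)) ` {..<N}"
  proof
    fix x assume "x \<in> slope_set r \<inter> slope_set s"
    then obtain n where x: "x = prod_encode (n, nat \<lfloor>r * real n\<rfloor>)"
      and "nat \<lfloor>r * real n\<rfloor> = nat \<lfloor>s * real n\<rfloor>"
      by (auto simp: slope_set_def prod_encode_eq)
    \<comment> \<open>Both floors are nonnegative, so \<open>nat\<close> does not identify different
      values.\<close>
    then have eq: "\<lfloor>r * real n\<rfloor> = \<lfloor>s * real n\<rfloor>"
      using assms by (simp add: nat_eq_iff2)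
    have "s * real n - r * real n < 1" using eq by linarith
    then have "real n < 1 / (s - r)" using assms by (simp add: field_simps)
    then show "x \<in> (\<lambda>n. prod_encode (n, nat \<lfloor>r * real n\<rfloor>)) ` {..<N}"
      using x N by auto
  qed
  then show ?thesis by (rule finite_subset) simp
qed

lemma finite_slope_set_Int:
  assumes "0 \<le> r" "0 \<le> s" "r \<noteq> s" shows "finite (slope_set r \<inter> slope_set s)"
  using assms finite_slope_set_Int_less[of r s] finite_slope_set_Int_less[of s r]
  by (cases "r < s") (auto simp: Int_commute)

lemma Sup_rationals_upto:
  fixes r :: real
  assumes "0 \<le> r"
  shows "Sup (insert 0 {q \<in> \<rat>. 0 < q \<and> q \<le> r}) = r"
proof (rule cSup_eq_non_empty)
  fix y assume y: "\<And>x. x \<in> insert 0 {q \<in> \<rat>. 0 < q \<and> q \<le> r} \<Longrightarrow> x \<le> y"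
  show "r \<le> y"
  proof (rule ccontr)
    assume "\<not> r \<le> y"
    then obtain q where "q \<in> \<rat>" "y < q" "q < r" using Rats_dense_in_real[of y r] by auto
    \<comment> \<open>The inserted 0 gives \<open>0 \<le> y\<close>, hence
      \<open>0 < q\<close>.\<close>
    then show False using y[of q] y[of 0] by auto
  qed
qed (use assms in auto)

section \<open>Attaining every value in the unit interval\<close>

context translation_ideal
begin

text \<open>Each \<open>X r\<close> is detected by its own index and hits no other one, so its
  density is exactly \<open>r\<close>. The value 0 comes from the empty set.\<close>

lemma rich_of_TAD_continuum:
  assumes pos: "\<And>r. X r \<subseteq> posnat" and notin: "\<And>r. X r \<notin> I"
    and disj: "\<And>r s k. 0 < r \<Longrightarrow> 0 < s \<Longrightarrow> r \<noteq> s \<Longrightarrow> X r \<inter> translate (X s) k \<in> I"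
  shows "rich (hit_density I X {0<..1})"
  unfolding rich_def
proof
  fix r :: real assume r: "r \<in> {0..1}"
  show "\<exists>A. A \<subseteq> posnat \<and> hit_density I X {0<..1} A = r"
  proof (cases "r = 0")
    case True
    have "hit_density I X {0<..1} {} = 0"
      using empty_in by (simp add: hit_density_def detected_in hits_eq_empty)
    with True show ?thesis by blast
  next
    case False
    then have r: "r \<in> {0<..1}" using r by auto
    have self: "r \<in> hits I X {0<..1} B" if "B \<subseteq> X r" "B \<notin> I" for B
      using that r by (auto simp: hits_def translate_0 pos Int_absorb2 intro!: exI[of _ 0])
    then have "detected I X {0<..1} (X r)" by (auto simp: detected_def)
    moreover have "hits I X {0<..1} (X r) = {r}"
      using self[of "X r"] notin r disj by (auto simp: hits_def)
    ultimately have "hit_density I X {0<..1} (X r) = r"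
      using r by (simp add: hit_density_def cSup_insert sup_real_def)
    with pos show ?thesis by blast
  qed
qed

end

context TAD_sequence
begin

lemma rich_of_detected_union:
  assumes T: "infinite T" "detected I (refined A) UNIV (union_over A T)"
  shows "\<exists>X K. K \<subseteq> {0<..1} \<and> 1 \<in> K \<and> X 1 \<subseteq> posnat \<and> X 1 \<notin> I \<and> rich (hit_density I X K)"
proof -
  \<comment> \<open>Rationals are countable, so \<open>f\<close> can inject them into
    \<open>T\<close>, and dense, so their suprema reach every real.\<close>
  define K :: "real set" where "K = {q \<in> \<rat>. 0 < q \<and> q \<le> 1}"
  define f where "f = enumerate T \<circ> to_nat_on K"
  define X where "X = refined A \<circ> f"
  have "countable K" unfolding K_def by (rule countable_subset[OF _ countable_rat]) auto
  then have inj: "inj_on f K"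
    unfolding f_def using T(1) by (intro comp_inj_on inj_on_to_nat_on)
      (auto intro: inj_on_subset[OF inj_enumerate])
  have f_in: "f q \<in> T" for q unfolding f_def using T(1) by (simp add: enumerate_in_set)
  have hits_eq: "hits I X K (union_over A (f ` Q)) = Q" if Q: "Q \<subseteq> K" for Q
  proof
    show "hits I X K (union_over A (f ` Q)) \<subseteq> Q"
    proof
      fix q assume "q \<in> hits I X K (union_over A (f ` Q))"
      then obtain k where q: "q \<in> K" and k: "union_over A (f ` Q) \<inter> translate (refined A (f q)) k \<notin> I"
        by (auto simp: hits_def X_def)
      then have "f q \<in> f ` Q"
        using union_over_Int_translate_in[of "f ` Q" "{f q}" k] by (auto simp: union_over_singleton)
      then show "q \<in> Q" using inj q Q by (auto dest: inj_onD)
    qed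
    show "Q \<subseteq> hits I X K (union_over A (f ` Q))"
    proof
      fix q assume q: "q \<in> Q"
      then have "refined A (f q) \<subseteq> union_over A (f ` Q)"
        by (auto simp: union_over_def)
      then have "union_over A (f ` Q) \<inter> translate (refined A (f q)) 0 \<notin> I"
        using refined_notin by (simp add: translate_0 refined_pos Int_absorb1)
      then show "q \<in> hits I X K (union_over A (f ` Q))"
        using q Q by (auto simp: hits_def X_def)
    qed
  qed
  have det: "detected I X K (union_over A (f ` K))"
    unfolding detected_def
  proof (intro allI impI)
    fix B assume B: "B \<subseteq> union_over A (f ` K)" "B \<notin> I"
    then have "B \<subseteq> union_over A T" using f_in by (auto simp: union_over_def)
    \<comment> \<open>The hypothesis yields a hit among all refined sets. A subset of the union over
      \<open>f\<close> K\<open>can only hit indices in\<close>f \<open>K\<close>, so passing to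
      fewer indices preserves detection.\<close>
    then obtain n k where k: "B \<inter> translate (refined A n) k \<notin> I"
      using B T(2) by (fastforce simp: detected_def hits_def)
    then have "union_over A (f ` K) \<inter> translate (refined A n) k \<notin> I"
      using B subset_in by blast
    then have "n \<in> f ` K"
      using union_over_Int_translate_in[of "f ` K" "{n}" k] by (auto simp: union_over_singleton)
    then show "hits I X K B \<noteq> {}" using k by (auto simp: hits_def X_def)
  qed
  have "rich (hit_density I X K)"
    unfolding rich_def
  proof
    fix r :: real assume r: "r \<in> {0..1}"
    define Q where "Q = {q \<in> \<rat>. 0 < q \<and> q \<le> r}"
    have Q: "Q \<subseteq> K" using r by (auto simp: Q_def K_def)
    then have "detected I X K (union_over A (f ` Q))"
      by (intro detected_subset[OF det]) (auto simp: union_over_def)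
    then have "hit_density I X K (union_over A (f ` Q)) = Sup (insert 0 Q)"
      by (simp add: hit_density_def hits_eq[OF Q])
    also have "\<dots> = r" unfolding Q_def using r by (intro Sup_rationals_upto) auto
    finally show "\<exists>A. A \<subseteq> posnat \<and> hit_density I X K A = r"
      using union_over_pos by blast
  qed
  moreover have "K \<subseteq> {0<..1}" "1 \<in> K" by (auto simp: K_def)
  moreover have "X 1 \<subseteq> posnat" "X 1 \<notin> I"
    using refined_pos refined_notin by (auto simp: X_def)
  ultimately show ?thesis by blast
qed

lemma rich_of_undetected_unions:
  assumes undet: "\<And>T. infinite T \<Longrightarrow> \<not> detected I (refined A) UNIV (union_over A T)"
  shows "\<exists>X K. K \<subseteq> {0<..1} \<and> 1 \<in> K \<and> X 1 \<subseteq> posnat \<and> X 1 \<notin> I \<and> rich (hit_density I X K)"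
proof -
  \<comment> \<open>Each slope set is infinite, so its union is undetected; \<open>B\<close> is a
    subset witnessing this.\<close>
  have "\<exists>B\<subseteq>union_over A (slope_set r). B \<notin> I \<and> hits I (refined A) UNIV B = {}" for r
    using undet[OF infinite_slope_set[of r]] unfolding detected_def by blast
  then obtain X where X: "\<And>r. X r \<subseteq> union_over A (slope_set r)" "\<And>r. X r \<notin> I"
    "\<And>r. hits I (refined A) UNIV (X r) = {}"
    by metis
  have pos: "X r \<subseteq> posnat" for r using X(1) union_over_pos by blast
  have "rich (hit_density I X {0<..1})"
  proof (rule rich_of_TAD_continuum[OF pos X(2)])
    fix r s :: real and k :: int
    assume "0 < r" "0 < s" "r \<noteq> s"
    then have "finite (slope_set r \<inter> slope_set s)" by (intro finite_slope_set_Int) auto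
    then show "X r \<inter> translate (X s) k \<in> I"
      using X(1)[of r] X(1)[of s] X(3)[of r] X(3)[of s]
      by (rule undetected_Int_translate_in)
  qed
  then show ?thesis using pos[of 1] X(2)[of 1]
    by (intro exI[of _ X] exI[of _ "{0<..1}"]) auto
qed

end

theorem theorem2p1:
  fixes I :: "nat set set"
  assumes "translation_invariant_ideal I"
    and "\<forall>F. F \<subseteq> posnat \<and> finite F \<longrightarrow> F \<in> I"
    and "\<exists>\<A>. infinite \<A> \<and> TAD_family I \<A>"
  shows "\<exists>\<delta> :: nat set \<Rightarrow> real.
           abstract_upper_density \<delta> \<and> translation_invariant_density \<delta> \<and> rich \<delta> \<and>
           zero_ideal \<delta> = I"
proof -
  obtain \<A> where \<A>: "infinite \<A>" "TAD_family I \<A>" using assms(3) by blast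
  obtain A :: "nat \<Rightarrow> nat set" where inj: "inj A" and range: "range A \<subseteq> \<A>"
    using infinite_countable_subset[OF \<A>(1)] by blast
  have mem: "A n \<in> \<A>" for n using range by auto
  interpret TAD_sequence I A
  proof
    show "translation_invariant_ideal I" by (rule assms(1))
    show "A n \<subseteq> posnat" "A n \<notin> I" for n
      using mem[of n] \<A>(2) by (auto simp: TAD_family_def)
    show "TAD I (A n) (A m)" if "n \<noteq> m" for n m
    proof -
      have "A n \<noteq> A m" using inj that by (auto dest: injD)
      then show ?thesis using mem[of n] mem[of m] \<A>(2) by (auto simp: TAD_family_def)
    qed
  qed
  have "\<exists>X K. K \<subseteq> {0<..1} \<and> 1 \<in> K \<and> X 1 \<subseteq> posnat \<and> X 1 \<notin> I \<and> rich (hit_density I X K)"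
  \<comment> \<open>Either case produces positive indices that include 1, which is what the density
    axioms require.\<close>
  proof (cases "\<exists>T. infinite T \<and> detected I (refined A) UNIV (union_over A T)")
    case True
    then show ?thesis using rich_of_detected_union by blast
  next
    case False
    then show ?thesis using rich_of_undetected_unions by blast
  qed
  then obtain X K where XK: "K \<subseteq> {0<..1}" "1 \<in> K" "X 1 \<subseteq> posnat" "X 1 \<notin> I"
    and rich: "rich (hit_density I X K)" by blast
  from hit_density_properties[where X = X, OF XK assms(2)] rich show ?thesis by blast
qed

end
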